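(* Let $(\underline P,\overline P)$ be a Vertical Barrier Model on $\mathcal A(\mathbb P)$ for which there are $A\in\mathcal A(\mathbb P)$ and $B\in\mathcal A(\mathbb P)\setminus\{\emptyset\}$ with $$0=\underline P(B)<\overline P(B),\qquad A^{\mathsf c}\wedge B\neq\emptyset\qquad\text{and}\qquad\overline P(A^{\mathsf c}\wedge B)=0.$$ Then $(\underline P,\overline P)$ is a Pari-Mutuel Model.
   Context: Let $\mathbb P$ be a partition (finite or infinite) of the sure event $\Omega$ and $\mathcal A(\mathbb P)$ the set of events logically dependent on $\mathbb P$, i.e. (identifying events with sets) the power set of $\mathbb P$, with $\Omega$ the whole set, $\emptyset$ the impossible event, $\wedge,{}^{\mathsf c}$ intersection and complement. "Probability" means finitely additive probability on $\mathcal A(\mathbb P)$. Vertical Barrier Model (VBM): given a probability $P_0$ on $\mathcal A(\mathbb P)$ and $b>0$, $a\le 0$ with $0\le a+b\le 1$, and $c=1-(a+b)$, put $\underline P(A)=\max\{bP_0(A)+a,0\}$ for $A\ne\Omega$, $\underline P(\Omega)=1$; $\overline P(A)=\min\{bP_0(A)+c,1\}$ for $A\ne\emptyset$, $\overline P(\emptyset)=0$. A Pari-Mutuel Model (PMM) is a VBM with $b=1+\delta$, $a=-\delta$ for some $\delta>0$ (hence $c=0$), i.e. $\underline P(A)=\max\{(1+\delta)P_0(A)-\delta,0\}$ and $\overline P(A)=\min\{(1+\delta)P_0(A),1\}$. *)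

theory Defs
  imports "HOL-Analysis.Measure_Space"
begin

text \<open>
  The partition is a set \<open>\<Omega>\<close> whose elements are its atoms. An event logically dependent on the
  partition is identified with the set of atoms it comprises, so the events are the members
  of \<open>Pow \<Omega>\<close> and \<open>\<Omega>\<close> itself is the sure event. Set functions are total in HOL, but
  only their values on \<open>Pow \<Omega>\<close> are ever constrained.
\<close>

definition fa_probability :: "'a set \<Rightarrow> ('a set \<Rightarrow> real) \<Rightarrow> bool" where
  "fa_probability \<Omega> P \<longleftrightarrow>
     (\<forall>A\<in>Pow \<Omega>. 0 \<le> P A) \<and> P \<Omega> = 1 \<and> Measure_Space.additive (Pow \<Omega>) P"

definition vbm_lower :: "'a set \<Rightarrow> ('a set \<Rightarrow> real) \<Rightarrow> real \<Rightarrow> real \<Rightarrow> 'a set \<Rightarrow> real" where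
  "vbm_lower \<Omega> P0 a b A = (if A = \<Omega> then 1 else max (b * P0 A + a) 0)"

definition vbm_upper :: "('a set \<Rightarrow> real) \<Rightarrow> real \<Rightarrow> real \<Rightarrow> 'a set \<Rightarrow> real" where
  "vbm_upper P0 a b A =
     (if A = {} then 0 else (let c = 1 - (a + b) in min (b * P0 A + c) 1))"

definition vbm_with ::
  "'a set \<Rightarrow> ('a set \<Rightarrow> real) \<Rightarrow> real \<Rightarrow> real \<Rightarrow> ('a set \<Rightarrow> real) \<Rightarrow> ('a set \<Rightarrow> real) \<Rightarrow> bool" where
  "vbm_with \<Omega> P0 a b lP uP \<longleftrightarrow>
     fa_probability \<Omega> P0 \<and> b > 0 \<and> a \<le> 0 \<and> 0 \<le> a + b \<and> a + b \<le> 1 \<and>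
     (\<forall>A\<in>Pow \<Omega>. lP A = vbm_lower \<Omega> P0 a b A \<and> uP A = vbm_upper P0 a b A)"

definition vertical_barrier_model ::
  "'a set \<Rightarrow> ('a set \<Rightarrow> real) \<Rightarrow> ('a set \<Rightarrow> real) \<Rightarrow> bool" where
  "vertical_barrier_model \<Omega> lP uP \<longleftrightarrow> (\<exists>P0 a b. vbm_with \<Omega> P0 a b lP uP)"

definition pari_mutuel_model ::
  "'a set \<Rightarrow> ('a set \<Rightarrow> real) \<Rightarrow> ('a set \<Rightarrow> real) \<Rightarrow> bool" where
  "pari_mutuel_model \<Omega> lP uP \<longleftrightarrow>
     (\<exists>P0 \<delta>. \<delta> > 0 \<and> vbm_with \<Omega> P0 (- \<delta>) (1 + \<delta>) lP uP)"

end

theory Submission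
  imports Defs
begin

text \<open>A nonempty event of upper probability 0 forces \<open>b * P0 E + c = 0\<close> with both
  summands nonnegative, so \<open>c = 0\<close>, that is \<open>a + b = 1\<close>. This is already
  the pari-mutuel shape with \<delta> = -a, except that \<delta> could be 0. In that case both
  bounds reduce to \<open>P0\<close> at \<open>B\<close>, which contradicts the gap between
  \<open>lP B\<close> and \<open>uP B\<close>.\<close>

theorem proposition7p3:
  fixes \<Omega> :: "'a set" and lP uP :: "'a set \<Rightarrow> real"
  assumes "vertical_barrier_model \<Omega> lP uP"
    and "\<exists>A\<in>Pow \<Omega>. \<exists>B\<in>Pow \<Omega> - {{}}.
           0 = lP B \<and> lP B < uP B \<and> (\<Omega> - A) \<inter> B \<noteq> {} \<and> uP ((\<Omega> - A) \<inter> B) = 0"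
  shows "pari_mutuel_model \<Omega> lP uP"
proof -
  obtain P0 a b where vbm: "vbm_with \<Omega> P0 a b lP uP"
    using assms(1) unfolding vertical_barrier_model_def by blast
  obtain A B where B: "B \<in> Pow \<Omega>" "B \<noteq> {}" "lP B = 0" "0 < uP B"
    and E: "(\<Omega> - A) \<inter> B \<noteq> {}" "uP ((\<Omega> - A) \<inter> B) = 0"
    using assms(2) by (metis DiffE insertI1)
  let ?E = "(\<Omega> - A) \<inter> B"
  have b: "b > 0" and a: "a \<le> 0" and ab: "a + b \<le> 1"
    and lP: "\<And>C. C \<in> Pow \<Omega> \<Longrightarrow> lP C = vbm_lower \<Omega> P0 a b C"
    and uP: "\<And>C. C \<in> Pow \<Omega> \<Longrightarrow> uP C = vbm_upper P0 a b C"
    and P0: "\<And>C. C \<in> Pow \<Omega> \<Longrightarrow> 0 \<le> P0 C"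
    using vbm unfolding vbm_with_def fa_probability_def by blast+
  have "?E \<in> Pow \<Omega>" by blast
  \<comment> \<open>As \<open>?E\<close> is nonempty, its upper value 0 comes from the min formula
    and not from the convention at the empty set.\<close>
  then have "min (b * P0 ?E + (1 - (a + b))) 1 = 0" and "0 \<le> b * P0 ?E"
    using E uP[of ?E] P0[of ?E] b by (simp_all add: vbm_upper_def)
  then have sum: "a + b = 1"
    using ab by (simp add: min_def split: if_splits)
  have "a \<noteq> 0"
  proof
    assume "a = 0"
    then have "b = 1" using sum by simp
    \<comment> \<open>The lower value at \<Omega> is set to 1, whereas \<open>lP B = 0\<close>;
      hence the max formula applies to \<open>B\<close>.\<close>
    have "B \<noteq> \<Omega>" using lP[OF B(1)] B(3) by (auto simp: vbm_lower_def)
    then have "max (P0 B) 0 = 0"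
      using lP[OF B(1)] B(3) \<open>a = 0\<close> \<open>b = 1\<close> by (simp add: vbm_lower_def)
    moreover have "0 < min (P0 B) 1"
      using uP[OF B(1)] B(2,4) \<open>a = 0\<close> \<open>b = 1\<close> by (simp add: vbm_upper_def)
    ultimately show False by simp
  qed
  moreover have "b = 1 + - a" using sum by simp
  \<comment> \<open>The same \<open>P0\<close> serves, with \<delta> = -a, positive because a \<le>
    0 and a \<noteq> 0.\<close>
  ultimately show ?thesis
    using a vbm unfolding pari_mutuel_model_def
    by (intro exI[of _ P0] exI[of _ "- a"]) simp
qed

end
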